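(* For any $\beta\in[0,1)$, Proportional Fairness is $\frac{27}{(1-\beta)^3}$-competitive for $\beta$-robust PSP: for every instance and every choice of the adversary, the total completion time of the resulting schedule is at most $\frac{27}{(1-\beta)^3}$ times the minimum total completion time of any feasible PSP schedule for the instance.
   Context: Polytope Scheduling Problem (PSP): there are jobs $j=1,\dots,n$ with release times $r_j\ge0$ and processing requirements $p_j>0$. A matrix $B=[b_{dj}]\in\mathbb R_{\ge0}^{D\times n}$ defines the downward-closed polytope $\mathcal P=\{y\in\mathbb R^n_{\ge0}: By\le\mathbf 1\}$. A feasible schedule selects at every time $t$ a rate vector $y(t)\in\mathcal P$ with $y_j(t)=0$ unless $j\in J(t)$, where $J(t)$ is the set of jobs released and not completed at $t$; job $j$ completes at the earliest time $C_j$ with $\int_{r_j}^{C_j}y_j(t)\,dt\ge p_j$. Objective: minimize $\sum_jC_j$. $\beta$-robust PSP: at each time $t$ the algorithm chooses $y(t)\in\mathcal P$ for $J(t)$; then an adversary chooses a set $N(t)\subseteq J(t)$ with $|N(t)|\le\beta|J(t)|$, and the processing actually applied is $\hat y_j(t)=y_j(t)$ if $j\notin N(t)$ and $\hat y_j(t)=0$ if $j\in N(t)$; completion times are determined by $\hat y$. Proportional Fairness (PF): at each time $t$, $y(t)$ is an optimal solution of: maximize $\sum_{j\in J(t)}\log y_j$ subject to $\sum_{j\in J(t)}b_{dj}y_j\le1$ for all $d\in[D]$, $y_j\ge0$ (with $y_j=0$ for $j\notin J(t)$). *)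

theory Defs
  imports "HOL-Analysis.Analysis"
begin

text \<open>Jobs are indexed by 0..<n, constraints (rows of B) by 0..<D.
  Rate vectors are functions nat => real; only coordinates j < n matter.\<close>

definition in_polytope :: "nat \<Rightarrow> nat \<Rightarrow> (nat \<Rightarrow> nat \<Rightarrow> real) \<Rightarrow> (nat \<Rightarrow> real) \<Rightarrow> bool" where
  "in_polytope n D B y \<longleftrightarrow>
     (\<forall>j<n. 0 \<le> y j) \<and> (\<forall>d<D. (\<Sum>j<n. B d j * y j) \<le> 1)"

definition completes_at :: "(nat \<Rightarrow> real) \<Rightarrow> (nat \<Rightarrow> real) \<Rightarrow> (real \<Rightarrow> nat \<Rightarrow> real) \<Rightarrow> nat \<Rightarrow> real \<Rightarrow> bool" where
  "completes_at r p yh j C \<longleftrightarrow>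
     r j \<le> C \<and> p j \<le> (LBINT t=r j..C. yh t j) \<and>
     (\<forall>\<tau>. r j \<le> \<tau> \<longrightarrow> \<tau> < C \<longrightarrow> (LBINT t=r j..\<tau>. yh t j) < p j)"

definition locally_integrable_rates :: "nat \<Rightarrow> (real \<Rightarrow> nat \<Rightarrow> real) \<Rightarrow> bool" where
  "locally_integrable_rates n y \<longleftrightarrow>
     (\<forall>j<n. \<forall>a b. set_integrable lborel {a..b} (\<lambda>t. y t j))"

definition active :: "nat \<Rightarrow> (nat \<Rightarrow> real) \<Rightarrow> (nat \<Rightarrow> real) \<Rightarrow> real \<Rightarrow> nat set" where
  "active n r C t = {j. j < n \<and> r j \<le> t \<and> t < C j}"

definition feasible_schedule ::
  "nat \<Rightarrow> nat \<Rightarrow> (nat \<Rightarrow> nat \<Rightarrow> real) \<Rightarrow> (nat \<Rightarrow> real) \<Rightarrow> (nat \<Rightarrow> real)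
   \<Rightarrow> (real \<Rightarrow> nat \<Rightarrow> real) \<Rightarrow> (nat \<Rightarrow> real) \<Rightarrow> bool" where
  "feasible_schedule n D B r p y C \<longleftrightarrow>
     (\<forall>t. in_polytope n D B (y t)) \<and>
     (\<forall>t. \<forall>j<n. j \<notin> active n r C t \<longrightarrow> y t j = 0) \<and>
     locally_integrable_rates n y \<and>
     (\<forall>j<n. completes_at r p y j (C j))"

text \<open>y is a Proportional Fairness allocation for the active set J: it maximizes
  the sum of logarithms over the polytope restricted to support J
  (the maximizer is strictly positive on J; log 0 = -infinity is encoded by
  requiring positivity of competitors).\<close>
definition PF_allocation :: "nat \<Rightarrow> nat \<Rightarrow> (nat \<Rightarrow> nat \<Rightarrow> real) \<Rightarrow> nat set \<Rightarrow> (nat \<Rightarrow> real) \<Rightarrow> bool" where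
  "PF_allocation n D B J y \<longleftrightarrow>
     in_polytope n D B y \<and> (\<forall>j<n. j \<notin> J \<longrightarrow> y j = 0) \<and> (\<forall>j\<in>J. 0 < y j) \<and>
     (\<forall>z. in_polytope n D B z \<and> (\<forall>j<n. j \<notin> J \<longrightarrow> z j = 0) \<and> (\<forall>j\<in>J. 0 < z j)
          \<longrightarrow> (\<Sum>j\<in>J. ln (z j)) \<le> (\<Sum>j\<in>J. ln (y j)))"

text \<open>A run of PF in the beta-robust setting against an (adaptive) adversary N:
  y is the PF allocation for the active set, N t is the adversary's set of
  non-processed jobs, and completion times C are determined by the actually
  applied rates.\<close>
definition applied_rates :: "(real \<Rightarrow> nat \<Rightarrow> real) \<Rightarrow> (real \<Rightarrow> nat set) \<Rightarrow> real \<Rightarrow> nat \<Rightarrow> real" where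
  "applied_rates y N t j = (if j \<in> N t then 0 else y t j)"

definition PF_robust_run ::
  "nat \<Rightarrow> nat \<Rightarrow> (nat \<Rightarrow> nat \<Rightarrow> real) \<Rightarrow> (nat \<Rightarrow> real) \<Rightarrow> (nat \<Rightarrow> real) \<Rightarrow> real
   \<Rightarrow> (real \<Rightarrow> nat \<Rightarrow> real) \<Rightarrow> (real \<Rightarrow> nat set) \<Rightarrow> (nat \<Rightarrow> real) \<Rightarrow> bool" where
  "PF_robust_run n D B r p \<beta> y N C \<longleftrightarrow>
     (\<forall>t. PF_allocation n D B (active n r C t) (y t)) \<and>
     (\<forall>t. N t \<subseteq> active n r C t \<and> real (card (N t)) \<le> \<beta> * real (card (active n r C t))) \<and>
     locally_integrable_rates n y \<and>
     locally_integrable_rates n (applied_rates y N) \<and>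
     (\<forall>j<n. completes_at r p (applied_rates y N) j (C j))"

end

theory Submission
  imports Defs
begin

text \<open>
  Fix a time \<open>t\<close> with active set \<open>A\<close>, put \<open>\<gamma> = 1 - \<beta>\<close> and \<open>\<kappa> = 9 / \<gamma>\<^sup>2\<close>, and let \<open>\<zeta>\<close> be the
  \<open>2\<gamma>/3\<close>-quantile of the ratios \<open>y\<^sub>j / p\<^sub>j\<close> over \<open>A\<close>. Let \<open>X\<^sub>j\<close> be the work done on \<open>j\<close> by the
  competing schedule until time \<open>t / \<kappa>\<close>. Jobs with ratio at most \<open>\<zeta>\<close> either have \<open>X\<^sub>j < p\<^sub>j\<close>, so that
  \<open>t < \<kappa> C'\<^sub>j\<close>, or satisfy \<open>1 \<le> X\<^sub>j / p\<^sub>j \<le> \<zeta> X\<^sub>j / y\<^sub>j\<close>. The average \<open>X / (t/\<kappa>)\<close> lies in the polytope, so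
  first-order optimality of PF bounds the sum of the \<open>\<zeta> X\<^sub>j / y\<^sub>j\<close> by \<open>\<zeta> (t/\<kappa>) |A|\<close>. At least
  \<open>(\<gamma>/3) |A|\<close> jobs outside \<open>N(t)\<close> have ratio at least \<open>\<zeta>\<close>, so \<open>\<zeta> |A|\<close> is paid for by the progress
  actually made. Integrating over \<open>t\<close>, each job makes total relative progress 1 before \<open>C\<^sub>j\<close>.
\<close>

text \<open>Take \<open>z\<close> to be the least value whose lower set has at least the fraction
  \<open>l\<close>. By minimality, the values strictly below \<open>z\<close> fill at most the
  fraction \<open>l\<close>. Ties at \<open>z\<close> count on both sides, so both bounds
  hold.\<close>

lemma exists_quantile:
  fixes v :: "'a \<Rightarrow> real" and l :: real
  assumes "finite A" "A \<noteq> {}" "0 \<le> l" "l \<le> 1"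
  obtains z where "z \<in> v ` A" "l * card A \<le> card {j\<in>A. v j \<le> z}"
    "(1 - l) * card A \<le> card {j\<in>A. z \<le> v j}"
proof -
  define Q where "Q = {z \<in> v ` A. l * card A \<le> card {j\<in>A. v j \<le> z}}"
  have finQ: "finite Q" unfolding Q_def using assms by simp
  have "{j\<in>A. v j \<le> Max (v ` A)} = A"
    using assms by auto
  moreover have "l * card A \<le> card A"
    using assms by (simp add: mult_left_le_one_le)
  ultimately have "Max (v ` A) \<in> Q"
    unfolding Q_def using assms by simp
  then have Qne: "Q \<noteq> {}" by auto
  define z where "z = Min Q"
  have zQ: "z \<in> Q" unfolding z_def using finQ Qne by simp
  have less: "card {j\<in>A. v j < z} \<le> l * card A"
  proof (cases "{j\<in>A. v j < z} = {}")
    case True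
    then show ?thesis using assms by (metis card.empty of_nat_0 of_nat_0_le_iff mult_nonneg_nonneg)
  next
    case False
    \<comment> \<open>No value lies strictly between \<open>z'\<close> and \<open>z\<close>, so
      \<open>v j < z\<close> and \<open>v j \<le> z'\<close> select the same elements, and
      minimality of \<open>z\<close> applies to \<open>z'\<close>.\<close>
    define z' where "z' = Max (v ` {j\<in>A. v j < z})"
    have z': "z' \<in> v ` {j\<in>A. v j < z}"
      unfolding z'_def using False assms by (intro Max_in) auto
    have eq: "{j\<in>A. v j \<le> z'} = {j\<in>A. v j < z}"
    proof (intro Collect_cong conj_cong refl)
      fix j assume "j \<in> A"
      show "v j \<le> z' \<longleftrightarrow> v j < z"
      proof
        assume "v j < z"
        then show "v j \<le> z'"
          unfolding z'_def using \<open>j \<in> A\<close> assms by (intro Max_ge) auto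
      qed (use z' in auto)
    qed
    have "z' < z" using z' by auto
    then have "z' \<notin> Q" using Min_le[OF finQ] unfolding z_def by (meson not_less)
    then show ?thesis using z' unfolding Q_def eq[symmetric] by auto
  qed
  have "card A = card {j\<in>A. v j < z} + card {j\<in>A. z \<le> v j}"
    using assms by (subst card_Un_disjoint[symmetric]) (auto intro!: arg_cong[where f=card])
  then have "real (card A) = card {j\<in>A. v j < z} + card {j\<in>A. z \<le> v j}"
    by simp
  then have "(1 - l) * card A \<le> card {j\<in>A. z \<le> v j}"
    using less by (simp add: algebra_simps)
  with zQ that show thesis unfolding Q_def by auto
qed

text \<open>Along the segment from \<open>y\<close> towards \<open>z\<close>, the log objective has
  slope (sum of \<open>z j / y j\<close>) - \<open>card A\<close> at \<open>y\<close>. A positive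
  slope would let a small step beat the maximizer.\<close>

lemma PF_allocation_first_order:
  assumes PF: "PF_allocation n D B A y" and A: "A \<subseteq> {..<n}"
    and B: "\<forall>d<D. \<forall>j<n. 0 \<le> B d j" and z: "in_polytope n D B z"
  shows "(\<Sum>j\<in>A. z j / y j) \<le> card A"
proof (rule ccontr)
  assume neg: "\<not> ?thesis"
  have finA: "finite A" using A finite_subset by blast
  have ypos: "\<And>j. j \<in> A \<Longrightarrow> 0 < y j" and y: "in_polytope n D B y"
    and y0: "\<And>j. j < n \<Longrightarrow> j \<notin> A \<Longrightarrow> y j = 0"
    using PF by (auto simp: PF_allocation_def)
  \<comment> \<open>Competitors must vanish outside \<open>A\<close>, so the convex combination is
    cut off there; since \<open>B\<close> is nonnegative, the cut keeps it in the polytope. Taking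
    \<open>e < 1\<close> below makes it positive on \<open>A\<close> even where
    \<open>z j = 0\<close>.\<close>
  define w where "w e j = (if j \<in> A then (1 - e) * y j + e * z j else 0)" for e j
  define f where "f e = (\<Sum>j\<in>A. ln (1 + e * (z j / y j - 1)))" for e
  have "(f has_real_derivative (\<Sum>j\<in>A. z j / y j - 1)) (at 0)"
    unfolding f_def by (auto intro!: derivative_eq_intros)
  moreover have "0 < (\<Sum>j\<in>A. z j / y j - 1)"
    using neg by (simp add: sum_subtractf)
  ultimately obtain d where d: "d > 0" "\<And>h. h > 0 \<Longrightarrow> h < d \<Longrightarrow> f 0 < f h"
    using DERIV_pos_inc_right[of f _ 0] by auto
  define e where "e = min (d/2) (1/2)"
  have e: "0 < e" "e < 1" "e < d" using d(1) by (auto simp: e_def)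
  have zn: "\<And>j. j \<in> A \<Longrightarrow> 0 \<le> z j" using z A by (auto simp: in_polytope_def)
  have wpos: "0 < w e j" if "j \<in> A" for j
    using that e ypos[OF that] zn[OF that] by (auto simp: w_def intro!: add_pos_nonneg)
  have "in_polytope n D B (w e)"
    unfolding in_polytope_def
  proof (intro conjI allI impI)
    show "0 \<le> w e j" if "j < n" for j
      using wpos[of j] by (cases "j \<in> A") (auto simp: w_def)
    fix c assume c: "c < D"
    have "(\<Sum>j<n. B c j * w e j) \<le> (\<Sum>j<n. B c j * ((1 - e) * y j + e * z j))"
      using B c e y z by (intro sum_mono mult_left_mono) (auto simp: w_def in_polytope_def)
    also have "\<dots> = (1 - e) * (\<Sum>j<n. B c j * y j) + e * (\<Sum>j<n. B c j * z j)"
      by (simp add: sum_distrib_left sum.distrib[symmetric] algebra_simps)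
    also have "\<dots> \<le> (1 - e) * 1 + e * 1"
      using e y z c by (intro add_mono mult_left_mono) (auto simp: in_polytope_def)
    finally show "(\<Sum>j<n. B c j * w e j) \<le> 1" by simp
  qed
  then have "(\<Sum>j\<in>A. ln (w e j)) \<le> (\<Sum>j\<in>A. ln (y j))"
    using PF wpos unfolding PF_allocation_def by (auto simp: w_def)
  moreover have "f e = (\<Sum>j\<in>A. ln (w e j)) - (\<Sum>j\<in>A. ln (y j))"
    unfolding f_def sum_subtractf[symmetric]
  proof (rule sum.cong[OF refl])
    fix j assume j: "j \<in> A"
    have "1 + e * (z j / y j - 1) = w e j / y j"
      using j ypos[OF j] by (simp add: w_def field_simps)
    then show "ln (1 + e * (z j / y j - 1)) = ln (w e j) - ln (y j)"
      using wpos[OF j] ypos[OF j] by (simp add: ln_div)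
  qed
  ultimately show False using d(2)[of e] e by (simp add: f_def)
qed

text \<open>\<open>completes_at\<close> gives only \<open>p j\<close> as a lower bound at
  \<open>C\<close>. The work is below \<open>p j\<close> before \<open>C\<close> and continuous in
  time, so it cannot overshoot. Positivity of \<open>p j\<close> ensures \<open>r j < C\<close>, so
  there is a left limit to take.\<close>

lemma completes_at_integral_eq:
  assumes comp: "completes_at r p y j C" and p: "0 < p j"
    and int: "\<And>a b. set_integrable lborel {a..b} (\<lambda>t. y t j)"
  shows "integral {r j..C} (\<lambda>t. y t j) = p j"
proof (rule antisym)
  let ?F = "\<lambda>x. integral {r j..x} (\<lambda>t. y t j)"
  have LB: "(LBINT t=r j..x. y t j) = ?F x" if "r j \<le> x" for x
    using that set_borel_integral_eq_integral(2)[OF int] by (simp add: interval_integral_Icc)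
  have rC: "r j \<le> C" and ge: "p j \<le> ?F C" and lt: "\<And>x. r j \<le> x \<Longrightarrow> x < C \<Longrightarrow> ?F x < p j"
    using comp LB by (auto simp: completes_at_def)
  show "p j \<le> ?F C" by (rule ge)
  have "r j \<noteq> C" using ge p by auto
  with rC have rC: "r j < C" by simp
  have "continuous_on {r j..C} ?F"
    using int set_borel_integral_eq_integral(1) by (intro indefinite_integral_continuous_1) blast
  then have "(?F \<longlongrightarrow> ?F C) (at C within {r j..C})"
    using rC by (simp add: continuous_on_def)
  then have "(?F \<longlongrightarrow> ?F C) (at_left C)"
    using rC by (simp add: at_within_Icc_at_left)
  moreover have "\<forall>\<^sub>F x in at_left C. ?F x \<le> p j"
    using eventually_at_left_real[OF rC] by eventually_elim (use lt in \<open>auto intro: less_imp_le\<close>)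
  ultimately show "?F C \<le> p j"
    by (rule tendsto_upperbound) simp
qed

lemma PF_pointwise_bound:
  fixes n :: nat and X p y :: "nat \<Rightarrow> real" and \<beta> u :: real
  assumes A: "A \<subseteq> {..<n}" and p: "\<forall>j<n. 0 < p j" and B: "\<forall>d<D. \<forall>j<n. 0 \<le> B d j"
    and PF: "PF_allocation n D B A y"
    and N: "N \<subseteq> A" "card N \<le> \<beta> * card A" and \<beta>: "0 \<le> \<beta>" "\<beta> < 1"
    and u: "0 < u" and X: "in_polytope n D B (\<lambda>j. X j / u)"
  shows "2 * (1 - \<beta>) / 3 * card A
    \<le> 3 * u / (1 - \<beta>) * (\<Sum>j\<in>A - N. y j / p j) + card {j\<in>A. X j < p j}"
proof (cases "A = {}")
  case False
  have finA: "finite A" using A finite_subset by blast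
  have pA: "\<And>j. j \<in> A \<Longrightarrow> 0 < p j" using A p by auto
  have ypos: "\<And>j. j \<in> A \<Longrightarrow> 0 < y j" using PF by (auto simp: PF_allocation_def)
  have Xn: "\<And>j. j \<in> A \<Longrightarrow> 0 \<le> X j" using X A u by (auto simp: in_polytope_def zero_le_divide_iff)
  define g where "g = 1 - \<beta>"
  have g: "0 < g" "g \<le> 1" using \<beta> by (auto simp: g_def)
  \<comment> \<open>The level \<open>2 * g / 3\<close> leaves a fraction of at least
    \<open>1 - 2 * g / 3\<close> at or above \<open>z\<close>; after the adversary removes at most
    \<open>\<beta> = 1 - g\<close>, the fraction \<open>g / 3\<close> still makes progress.\<close>
  obtain z where z: "z \<in> (\<lambda>j. y j / p j) ` A"
    and lo: "2 * g / 3 * card A \<le> card {j\<in>A. y j / p j \<le> z}"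
    and hi: "(1 - 2 * g / 3) * card A \<le> card {j\<in>A. z \<le> y j / p j}"
    by (rule exists_quantile[OF finA False, of "2 * g / 3" "\<lambda>j. y j / p j"]) (use g in auto)
  have z0: "0 < z" using z ypos pA by auto
  define H where "H = {j\<in>A. z \<le> y j / p j} - N"
  have "card {j\<in>A. z \<le> y j / p j} \<le> card (H \<union> N)"
    using finA N finite_subset[OF N(1)] by (intro card_mono) (auto simp: H_def)
  also have "\<dots> \<le> card H + card N" by (rule card_Un_le)
  finally have "real (card {j\<in>A. z \<le> y j / p j}) \<le> card H + card N" by simp
  then have H: "g / 3 * card A \<le> card H"
    using hi N(2) by (simp add: g_def field_simps)
  have "z * (g / 3 * card A) \<le> z * card H"
    using H z0 by (intro mult_left_mono) auto
  also have "\<dots> = (\<Sum>j\<in>H. z)" by simp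
  also have "\<dots> \<le> (\<Sum>j\<in>H. y j / p j)"
    by (intro sum_mono) (auto simp: H_def)
  also have "\<dots> \<le> (\<Sum>j\<in>A - N. y j / p j)"
    using finA ypos pA by (intro sum_mono2) (auto simp: H_def intro!: less_imp_le[OF divide_pos_pos])
  finally have progress: "z * card A \<le> 3 / g * (\<Sum>j\<in>A - N. y j / p j)"
    using g by (simp add: field_simps)
  define L where "L = {j\<in>A. y j / p j \<le> z \<and> p j \<le> X j}"
  have "real (card L) = (\<Sum>j\<in>L. 1)" by simp
  also have "\<dots> \<le> (\<Sum>j\<in>L. z * (X j / y j))"
  proof (intro sum_mono)
    fix j assume "j \<in> L"
    then have j: "j \<in> A" "y j / p j \<le> z" "p j \<le> X j" by (auto simp: L_def)
    have "y j \<le> z * p j" using j pA[OF j(1)] by (simp add: field_simps)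
    also have "\<dots> \<le> z * X j" using j z0 by simp
    finally show "1 \<le> z * (X j / y j)" using ypos[OF j(1)] by (simp add: field_simps)
  qed
  also have "\<dots> \<le> (\<Sum>j\<in>A. z * (X j / y j))"
    using finA z0 Xn ypos
    by (intro sum_mono2) (auto simp: L_def less_imp_le intro!: mult_nonneg_nonneg divide_nonneg_pos)
  also have "\<dots> = z * u * (\<Sum>j\<in>A. X j / u / y j)"
    using u by (simp add: sum_distrib_left)
  also have "\<dots> \<le> z * u * card A"
    using PF_allocation_first_order[OF PF A B X] u z0 by (intro mult_left_mono) auto
  also have "\<dots> = u * (z * card A)" by simp
  also have "\<dots> \<le> u * (3 / g * (\<Sum>j\<in>A - N. y j / p j))"
    using progress u by (intro mult_left_mono) auto
  finally have L: "card L \<le> 3 * u / g * (\<Sum>j\<in>A - N. y j / p j)" by (simp add: mult_ac)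
  have "card {j\<in>A. y j / p j \<le> z} \<le> card (L \<union> {j\<in>A. X j < p j})"
    using finA by (intro card_mono) (auto simp: L_def)
  also have "\<dots> \<le> card L + card {j\<in>A. X j < p j}" by (rule card_Un_le)
  finally have "real (card {j\<in>A. y j / p j \<le> z}) \<le> card L + card {j\<in>A. X j < p j}" by simp
  with lo L show ?thesis unfolding g_def by linarith
qed auto

text \<open>The constraints are linear, so they survive averaging over time; this makes the
  competitor's average rate a valid comparison point for PF.\<close>

lemma average_rate_in_polytope:
  assumes "\<And>t. in_polytope n D B (x t)" and int: "\<And>j. j < n \<Longrightarrow> (\<lambda>t. x t j) integrable_on {0..u}"
    and u: "0 < u"
  shows "in_polytope n D B (\<lambda>j. integral {0..u} (\<lambda>t. x t j) / u)"
  unfolding in_polytope_def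
proof (intro conjI allI impI)
  show "0 \<le> integral {0..u} (\<lambda>t. x t j) / u" if "j < n" for j
    using assms that by (auto simp: in_polytope_def intro!: divide_nonneg_pos integral_nonneg)
  fix d assume d: "d < D"
  have "(\<Sum>j<n. B d j * (integral {0..u} (\<lambda>t. x t j) / u))
      = (\<Sum>j<n. integral {0..u} (\<lambda>t. B d j * x t j)) / u"
    by (simp add: sum_divide_distrib)
  also have "\<dots> = integral {0..u} (\<lambda>t. \<Sum>j<n. B d j * x t j) / u"
    using int by (subst integral_sum) (auto intro!: integrable_on_mult_right)
  also have "\<dots> \<le> integral {0..u} (\<lambda>t. 1) / u"
    using u assms(1) d int
    by (intro divide_right_mono integral_le integrable_sum integrable_on_mult_right)
       (auto simp: in_polytope_def)
  also have "\<dots> = 1" using u by simp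
  finally show "(\<Sum>j<n. B d j * (integral {0..u} (\<lambda>t. x t j) / u)) \<le> 1" .
qed

text \<open>Half-open intervals match \<open>active\<close>, where a job leaves at its completion
  time.\<close>

lemma has_integral_indicator_atLeastLessThan:
  fixes a b T :: real
  assumes "0 \<le> a" "a \<le> b" "b \<le> T"
  shows "(indicator {a..<b} has_integral (b - a)) {0..T}"
proof -
  have "((\<lambda>t. 1 :: real) has_integral (b - a)) {a..b}"
    using has_integral_const_real[of "1 :: real" a b] assms by simp
  then have "((\<lambda>t. if t \<in> {a..b} then 1 else 0 :: real) has_integral (b - a)) {0..T}"
    using assms by (subst has_integral_restrict) auto
  then show ?thesis
    by (rule has_integral_spike_finite[of "{b}", rotated 2]) (auto simp: indicator_def)
qed

theorem mainTheorem9: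
  fixes n D :: nat and B :: "nat \<Rightarrow> nat \<Rightarrow> real" and r p :: "nat \<Rightarrow> real" and \<beta> :: real
  assumes "0 \<le> \<beta>" and "\<beta> < 1"
    and "\<forall>j<n. 0 \<le> r j" and "\<forall>j<n. 0 < p j"
    and "\<forall>d<D. \<forall>j<n. 0 \<le> B d j"
    and "PF_robust_run n D B r p \<beta> y N C"
    and "feasible_schedule n D B r p y' C'"
  shows "(\<Sum>j<n. C j) \<le> 27 / (1 - \<beta>) ^ 3 * (\<Sum>j<n. C' j)"
proof -
  define g where "g = 1 - \<beta>"
  have g: "0 < g" "g \<le> 1" using assms(1,2) by (auto simp: g_def)
  \<comment> \<open>This choice gives \<open>3 * (t / k) / g = g / 3 * t\<close>, so the progress
    term absorbs exactly half of the factor \<open>2 * g / 3\<close>. The remaining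
    \<open>g / 3\<close> yields the ratio \<open>k / (g / 3) = 27 / g ^ 3\<close>.\<close>
  define k where "k = 9 / g\<^sup>2"
  have "g\<^sup>2 \<le> 1" using g by (simp add: power_le_one)
  then have k: "1 \<le> k" using g by (simp add: k_def field_simps)
  let ?A = "active n r C"
  let ?yh = "applied_rates y N"
  have PF: "\<And>t. PF_allocation n D B (?A t) (y t)"
    and N: "\<And>t. N t \<subseteq> ?A t" "\<And>t. real (card (N t)) \<le> \<beta> * real (card (?A t))"
    and yh_int: "\<And>j a b. j < n \<Longrightarrow> set_integrable lborel {a..b} (\<lambda>t. ?yh t j)"
    and C: "\<And>j. j < n \<Longrightarrow> completes_at r p ?yh j (C j)"
    using assms(6) by (auto simp: PF_robust_run_def locally_integrable_rates_def)
  have y'P: "\<And>t. in_polytope n D B (y' t)"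
    and y'_int: "\<And>j a b. j < n \<Longrightarrow> set_integrable lborel {a..b} (\<lambda>t. y' t j)"
    and C': "\<And>j. j < n \<Longrightarrow> completes_at r p y' j (C' j)"
    using assms(7) by (auto simp: feasible_schedule_def locally_integrable_rates_def)
  have r: "0 \<le> r j" "r j \<le> C j" "r j \<le> C' j" "r j \<le> k * C' j" if "j < n" for j
  proof -
    show *: "0 \<le> r j" "r j \<le> C j" "r j \<le> C' j"
      using that assms(3) C C' by (auto simp: completes_at_def)
    then show "r j \<le> k * C' j"
      using mult_right_mono[of 1 k "C' j"] k by auto
  qed
  define X where "X u j = integral {0..u} (\<lambda>t. y' t j)" for u j
  have y'_HK: "(\<lambda>t. y' t j) integrable_on {a..b}" if "j < n" for j a b
    using y'_int[OF that] set_borel_integral_eq_integral(1) by blast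
  have X_ge: "p j \<le> X u j" if j: "j < n" and u: "C' j \<le> u" for j u
  proof -
    have "p j \<le> integral {r j..C' j} (\<lambda>t. y' t j)"
      using C'[OF j] r[OF j] set_borel_integral_eq_integral(2)[OF y'_int[OF j]]
      by (auto simp: completes_at_def interval_integral_Icc)
    also have "\<dots> \<le> X u j"
      unfolding X_def using r[OF j] u y'P y'_HK[OF j] j
      by (intro integral_subset_le) (auto simp: in_polytope_def)
    finally show ?thesis .
  qed
  have yh: "?yh t j = (if j \<in> ?A t - N t then y t j else 0)" if "j < n" for t j
    using PF[of t] that by (auto simp: applied_rates_def PF_allocation_def)
  have yh_nonneg: "0 \<le> ?yh t j" if "j < n" for t j
    using PF[of t] that by (auto simp: applied_rates_def PF_allocation_def in_polytope_def)
  have fin: "finite (?A t)" for t by (simp add: active_def)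

  \<comment> \<open>The active count is written with indicators so that integration turns it into
    flow times. Time 0 is excluded because the averaging window \<open>t / k\<close> must have
    positive length.\<close>
  have pointwise: "(\<Sum>j<n. 2 * g / 3 * indicator {r j..<C j} t)
      \<le> (\<Sum>j<n. g / 3 * (C j / p j) * ?yh t j + indicator {r j..<k * C' j} t)" if t: "0 < t" for t
  proof -
    have "(\<Sum>j<n. 2 * g / 3 * indicator {r j..<C j} t) = 2 * g / 3 * card (?A t)"
    proof -
      have "(\<Sum>j<n. indicator {r j..<C j} t) = (\<Sum>j<n. if j \<in> ?A t then 1 else 0 :: real)"
        by (intro sum.cong) (auto simp: active_def indicator_def)
      also have "\<dots> = card ({..<n} \<inter> ?A t)"
        by (simp add: sum.If_cases)
      also have "{..<n} \<inter> ?A t = ?A t" by (auto simp: active_def)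
      finally show ?thesis unfolding sum_distrib_left[symmetric] by simp
    qed
    also have "\<dots> \<le> 3 * (t / k) / g * (\<Sum>j\<in>?A t - N t. y t j / p j)
        + card {j\<in>?A t. X (t / k) j < p j}"
      unfolding g_def
    proof (rule PF_pointwise_bound[OF _ assms(4,5) PF N assms(1,2)])
      show "?A t \<subseteq> {..<n}" by (auto simp: active_def)
      show "0 < t / k" using t k by simp
      then show "in_polytope n D B (\<lambda>j. X (t / k) j / (t / k))"
        unfolding X_def by (intro average_rate_in_polytope y'P y'_HK)
    qed
    also have "3 * (t / k) / g * (\<Sum>j\<in>?A t - N t. y t j / p j)
        = (\<Sum>j<n. g / 3 * (t / p j) * ?yh t j)"
    proof -
      have "(\<Sum>j\<in>?A t - N t. y t j / p j) = (\<Sum>j<n. ?yh t j / p j)"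
        by (intro sum.mono_neutral_cong_left) (auto simp: yh active_def)
      moreover have "3 * (t / k) / g = g / 3 * t"
        using g by (simp add: k_def field_simps power2_eq_square)
      ultimately have "3 * (t / k) / g * (\<Sum>j\<in>?A t - N t. y t j / p j)
          = g / 3 * t * (\<Sum>j<n. ?yh t j / p j)" by metis
      then show ?thesis by (simp add: sum_distrib_left)
    qed
    \<comment> \<open>A job has nonzero rate only while \<open>t < C j\<close>; replacing
      \<open>t\<close> by \<open>C j\<close> makes the weight constant in time, so the integral of
      the rate can be evaluated.\<close>
    also have "\<dots> \<le> (\<Sum>j<n. g / 3 * (C j / p j) * ?yh t j)"
    proof (intro sum_mono)
      fix j assume "j \<in> {..<n}"
      then have j: "j < n" by simp
      show "g / 3 * (t / p j) * ?yh t j \<le> g / 3 * (C j / p j) * ?yh t j"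
      proof (cases "j \<in> ?A t")
        case True
        then show ?thesis
          using j g yh_nonneg[OF j] assms(4)
          by (intro mult_right_mono mult_left_mono divide_right_mono)
             (auto simp: active_def less_imp_le)
      qed (simp add: yh[OF j])
    qed
    also have "real (card {j\<in>?A t. X (t / k) j < p j}) \<le> (\<Sum>j<n. indicator {r j..<k * C' j} t)"
    proof -
      have "real (card {j\<in>?A t. X (t / k) j < p j})
          = (\<Sum>j\<in>{j\<in>?A t. X (t / k) j < p j}. 1)" by simp
      also have "\<dots> \<le> (\<Sum>j\<in>{j\<in>?A t. X (t / k) j < p j}. indicator {r j..<k * C' j} t)"
      proof (intro sum_mono)
        fix j assume "j \<in> {j\<in>?A t. X (t / k) j < p j}"
        then have j: "j < n" "r j \<le> t" "X (t / k) j < p j" by (auto simp: active_def)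
        \<comment> \<open>Contrapositive of \<open>X_ge\<close>: a job short of \<open>p j\<close>
          at time \<open>t / k\<close> is unfinished in the competing schedule.\<close>
        then have "t / k < C' j" using X_ge[of j "t / k"] by force
        then show "1 \<le> (indicator {r j..<k * C' j} t :: real)"
          using j k by (simp add: field_simps)
      qed
      also have "\<dots> \<le> (\<Sum>j<n. indicator {r j..<k * C' j} t)"
        by (intro sum_mono2) (auto simp: active_def)
      finally show ?thesis .
    qed
    finally show ?thesis by (simp add: sum.distrib)
  qed

  \<comment> \<open>A common horizon covering all intervals that occur in the pointwise
    bound.\<close>
  define T where "T = (\<Sum>j<n. C j + k * C' j)"
  have T: "C j \<le> T" "k * C' j \<le> T" if j: "j < n" for j
  proof -
    have "0 \<le> C i + k * C' i" if "i < n" for i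
      using r[OF that] by linarith
    then have "C j + k * C' j \<le> T"
      unfolding T_def using j by (intro member_le_sum) auto
    with r[OF j] show "C j \<le> T" "k * C' j \<le> T" by auto
  qed
  have yh_has: "((\<lambda>t. ?yh t j) has_integral p j) {0..T}" if j: "j < n" for j
  proof -
    have "(\<lambda>t. ?yh t j) integrable_on {r j..C j}"
      using yh_int[OF j] set_borel_integral_eq_integral(1) by blast
    moreover have "integral {r j..C j} (\<lambda>t. ?yh t j) = p j"
      using completes_at_integral_eq[OF C[OF j]] assms(4) j yh_int[OF j] by blast
    ultimately have "((\<lambda>t. ?yh t j) has_integral p j) {r j..C j}"
      by (metis integrable_integral)
    moreover have "{r j..C j} \<subseteq> {0..T}" using r[OF j] T[OF j] by auto
    moreover have "?yh t j = 0" if "t \<notin> {r j..C j}" for t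
      using that yh[OF j] by (auto simp: active_def)
    ultimately show ?thesis using has_integral_on_superset by blast
  qed
  have "(\<Sum>j<n. 2 * g / 3 * (C j - r j))
      \<le> (\<Sum>j<n. g / 3 * (C j / p j) * p j + (k * C' j - r j))"
  proof (rule has_integral_le)
    let ?f = "\<lambda>t. \<Sum>j<n. 2 * g / 3 * indicator {r j..<C j} t"
    have "(?f has_integral (\<Sum>j<n. 2 * g / 3 * (C j - r j))) {0..T}"
      using r T by (intro has_integral_sum has_integral_mult_right
          has_integral_indicator_atLeastLessThan) auto
    then show "((\<lambda>t. if t = 0 then 0 else ?f t) has_integral
        (\<Sum>j<n. 2 * g / 3 * (C j - r j))) {0..T}"
      by (rule has_integral_spike_finite[of "{0}", rotated 2]) auto
    show "((\<lambda>t. \<Sum>j<n. g / 3 * (C j / p j) * ?yh t j + indicator {r j..<k * C' j} t)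
        has_integral (\<Sum>j<n. g / 3 * (C j / p j) * p j + (k * C' j - r j))) {0..T}"
      using r T yh_has by (intro has_integral_sum has_integral_add has_integral_mult_right
          has_integral_indicator_atLeastLessThan) auto
    fix t assume "t \<in> {0..T}"
    moreover have "0 \<le> (\<Sum>j<n. g / 3 * (C j / p j) * ?yh t j + indicator {r j..<k * C' j} t)"
      using g yh_nonneg assms(4) order_trans[OF r(1,2)]
      by (intro sum_nonneg add_nonneg_nonneg mult_nonneg_nonneg divide_nonneg_pos) auto
    ultimately show "(if t = 0 then 0 else ?f t)
        \<le> (\<Sum>j<n. g / 3 * (C j / p j) * ?yh t j + indicator {r j..<k * C' j} t)"
      using pointwise[of t] by (cases "t = 0") auto
  qed
  also have "\<dots> = (\<Sum>j<n. g / 3 * C j + (k * C' j - r j))"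
    using assms(4) by (intro sum.cong) (auto simp: less_imp_neq[THEN not_sym])
  finally have "2 * g / 3 * (\<Sum>j<n. C j) - 2 * g / 3 * (\<Sum>j<n. r j)
      \<le> g / 3 * (\<Sum>j<n. C j) + k * (\<Sum>j<n. C' j) - (\<Sum>j<n. r j)"
    by (simp only: sum.distrib sum_subtractf sum_distrib_left[symmetric] right_diff_distrib add_diff_eq)
  moreover have "2 * g / 3 * (\<Sum>j<n. r j) \<le> 1 * (\<Sum>j<n. r j)"
    using g r by (intro mult_right_mono sum_nonneg) auto
  ultimately have "g / 3 * (\<Sum>j<n. C j) \<le> k * (\<Sum>j<n. C' j)" by linarith
  then show ?thesis
    using g unfolding k_def g_def[symmetric]
    by (simp add: field_simps power2_eq_square power3_eq_cube)
qed

end
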